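(* Let $(\Gamma,\preceq)$ be an ordered group. Let $S^+$ be the set of elements $h\succ 1$ such that $h\preceq w$ for every crossing $(f,g,u,v,w)$ satisfying $1\preceq u$; let $S^-$ be the set of elements $h\prec 1$ such that $w\preceq h$ for every crossing $(f,g,u,v,w)$ satisfying $v\preceq 1$; and let $S=\{1\}\cup S^+\cup S^-$. Then the Conradian soul of $(\Gamma,\preceq)$ coincides with $S$.
   Context: An ordered group $(\Gamma,\preceq)$ is a group with a total order relation (an ordering) invariant under left multiplication. The ordering is Conradian if for all $f\succ1$ and $g\succ 1$ there exists $n\in\mathbb{N}$ (positive integers) such that $fg^n\succ g$. A subgroup is $\preceq$-Conradian if the restriction of $\preceq$ to it is Conradian. A subset $T\subseteq\Gamma$ is $\preceq$-convex if whenever $f_1\prec f\prec f_2$ with $f_1,f_2\in T$ and $f\in\Gamma$, then $f\in T$. The Conradian soul $C_{\preceq}(\Gamma)$ is the (unique) subgroup which is $\preceq$-convex, $\preceq$-Conradian, and maximal among subgroups having these two properties simultaneously. A crossing for $(\Gamma,\preceq)$ is a 5-uple $(f,g,u,v,w)$ of elements of $\Gamma$ such that: (i) $u\prec w\prec v$; (ii) $g^n u\prec v$ and $f^n v\succ u$ for every $n\in\mathbb{N}$; (iii) there exist $M,N\in\mathbb{N}$ such that $f^N v\prec w\prec g^M u$. *)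

theory Defs
  imports "HOL-Algebra.Group"
begin

abbreviation preceq :: "'a \<Rightarrow> 'a rel \<Rightarrow> 'a \<Rightarrow> bool" ("(_ \<preceq>\<^bsub>_\<^esub> _)" [51, 0, 51] 50)
  where "x \<preceq>\<^bsub>R\<^esub> y \<equiv> (x, y) \<in> R"

abbreviation prec :: "'a \<Rightarrow> 'a rel \<Rightarrow> 'a \<Rightarrow> bool" ("(_ \<prec>\<^bsub>_\<^esub> _)" [51, 0, 51] 50)
  where "x \<prec>\<^bsub>R\<^esub> y \<equiv> (x, y) \<in> R \<and> x \<noteq> y"

locale ordered_group = group G for G (structure) +
  fixes R :: "'a rel"
  assumes linear_order: "linear_order_on (carrier G) R"
    and left_invariant:
      "\<lbrakk>h \<in> carrier G; x \<in> carrier G; y \<in> carrier G; x \<preceq>\<^bsub>R\<^esub> y\<rbrakk> \<Longrightarrow> h \<otimes> x \<preceq>\<^bsub>R\<^esub> h \<otimes> y"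

text \<open>Throughout, exponents quantified over the positive integers carry an explicit bound
  \<open>n \<ge> 1\<close>.\<close>

definition conradian :: "('a, 'b) monoid_scheme \<Rightarrow> 'a rel \<Rightarrow> bool"
  where "conradian G R \<longleftrightarrow>
    (\<forall>f\<in>carrier G. \<forall>g\<in>carrier G. \<one>\<^bsub>G\<^esub> \<prec>\<^bsub>R\<^esub> f \<longrightarrow> \<one>\<^bsub>G\<^esub> \<prec>\<^bsub>R\<^esub> g \<longrightarrow>
      (\<exists>n::nat. n \<ge> 1 \<and> g \<prec>\<^bsub>R\<^esub> f \<otimes>\<^bsub>G\<^esub> g [^]\<^bsub>G\<^esub> n))"

definition conradian_subgroup :: "('a, 'b) monoid_scheme \<Rightarrow> 'a rel \<Rightarrow> 'a set \<Rightarrow> bool"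
  where "conradian_subgroup G R H \<longleftrightarrow>
    subgroup H G \<and> conradian (G\<lparr>carrier := H\<rparr>) (Restr R H)"

definition convex_subset :: "('a, 'b) monoid_scheme \<Rightarrow> 'a rel \<Rightarrow> 'a set \<Rightarrow> bool"
  where "convex_subset G R T \<longleftrightarrow> T \<subseteq> carrier G \<and>
    (\<forall>f\<^sub>1\<in>T. \<forall>f\<^sub>2\<in>T. \<forall>f\<in>carrier G. f\<^sub>1 \<prec>\<^bsub>R\<^esub> f \<and> f \<prec>\<^bsub>R\<^esub> f\<^sub>2 \<longrightarrow> f \<in> T)"

definition is_conradian_soul :: "('a, 'b) monoid_scheme \<Rightarrow> 'a rel \<Rightarrow> 'a set \<Rightarrow> bool"
  where "is_conradian_soul G R C \<longleftrightarrow>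
    convex_subset G R C \<and> conradian_subgroup G R C \<and>
    (\<forall>H. convex_subset G R H \<and> conradian_subgroup G R H \<and> C \<subseteq> H \<longrightarrow> H = C)"

definition crossing ::
  "('a, 'b) monoid_scheme \<Rightarrow> 'a rel \<Rightarrow> 'a \<Rightarrow> 'a \<Rightarrow> 'a \<Rightarrow> 'a \<Rightarrow> 'a \<Rightarrow> bool"
  where "crossing G R f g u v w \<longleftrightarrow>
    f \<in> carrier G \<and> g \<in> carrier G \<and> u \<in> carrier G \<and> v \<in> carrier G \<and> w \<in> carrier G \<and>
    u \<prec>\<^bsub>R\<^esub> w \<and> w \<prec>\<^bsub>R\<^esub> v \<and>
    (\<forall>n::nat. n \<ge> 1 \<longrightarrow>
      g [^]\<^bsub>G\<^esub> n \<otimes>\<^bsub>G\<^esub> u \<prec>\<^bsub>R\<^esub> v \<and> u \<prec>\<^bsub>R\<^esub> f [^]\<^bsub>G\<^esub> n \<otimes>\<^bsub>G\<^esub> v) \<and>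
    (\<exists>(M::nat) (N::nat). M \<ge> 1 \<and> N \<ge> 1 \<and>
      f [^]\<^bsub>G\<^esub> N \<otimes>\<^bsub>G\<^esub> v \<prec>\<^bsub>R\<^esub> w \<and> w \<prec>\<^bsub>R\<^esub> g [^]\<^bsub>G\<^esub> M \<otimes>\<^bsub>G\<^esub> u)"

definition S_plus :: "('a, 'b) monoid_scheme \<Rightarrow> 'a rel \<Rightarrow> 'a set"
  where "S_plus G R = {h \<in> carrier G. \<one>\<^bsub>G\<^esub> \<prec>\<^bsub>R\<^esub> h \<and>
    (\<forall>f g u v w. crossing G R f g u v w \<and> \<one>\<^bsub>G\<^esub> \<preceq>\<^bsub>R\<^esub> u \<longrightarrow> h \<preceq>\<^bsub>R\<^esub> w)}"

definition S_minus :: "('a, 'b) monoid_scheme \<Rightarrow> 'a rel \<Rightarrow> 'a set"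
  where "S_minus G R = {h \<in> carrier G. h \<prec>\<^bsub>R\<^esub> \<one>\<^bsub>G\<^esub> \<and>
    (\<forall>f g u v w. crossing G R f g u v w \<and> v \<preceq>\<^bsub>R\<^esub> \<one>\<^bsub>G\<^esub> \<longrightarrow> w \<preceq>\<^bsub>R\<^esub> h)}"

end

theory Submission
  imports Defs
begin

text \<open>
  Read a group element as an order-preserving map of the ordered set \<open>G\<close>, acting by left
  multiplication. In a crossing, \<open>f\<close> pushes \<open>v\<close> down below \<open>w\<close> without ever reaching \<open>u\<close>, and \<open>g\<close>
  pushes \<open>u\<close> up above \<open>w\<close> without ever reaching \<open>v\<close>. Such a configuration is the same thing as a
  failure of the Conradian condition. If \<open>f g\<^sup>n \<preceq> g\<close> for all \<open>n\<close>, with \<open>f, g \<succ> 1\<close>, then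
  \<open>(f, g, 1, f\<inverse>g, g\<^sup>2)\<close> is a crossing (\<open>crossing_if_not_conradian\<close>). Conversely, once \<open>f\<close> and \<open>g\<close>
  are replaced by powers that do their work in one step, \<open>w\<inverse>(gf)w\<close> and \<open>w\<inverse>gw\<close> violate the
  condition (\<open>strong_crossing_not_conradian\<close>).

  If \<open>H\<close> is a convex Conradian subgroup and some positive \<open>h \<in> H\<close> lies above the point \<open>w\<close> of a
  crossing with \<open>1 \<preceq> u\<close>, then \<open>u\<close> and \<open>w\<close> are in \<open>H\<close> by convexity, and so are the relevant powers of
  \<open>f\<close> and \<open>g\<close>, because they move a point of \<open>H\<close> to a point of \<open>H\<close>. The crossing thus takes place in
  \<open>H\<close>, which is absurd. Hence \<open>H \<subseteq> S\<close>.

  It remains to see that \<open>S\<close> is itself a convex Conradian subgroup; it is then the largest one.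
  Convexity is clear. The group laws rest on moving crossings around: \<open>G\<close> acts on crossings by
  conjugating \<open>f, g\<close> and translating \<open>u, v, w\<close>, and every crossing over the interval from \<open>u\<close> to \<open>v\<close>
  contains one over the interval from \<open>w\<close> to \<open>v\<close> (\<open>upper_crossing\<close>). If, for positive \<open>h, h\<^sub>1, h\<^sub>2\<close>,
  some crossing excludes \<open>h\<inverse>\<close> from \<open>S\<close>, or excludes \<open>h\<^sub>1h\<^sub>2\<close> although \<open>h\<^sub>1 \<in> S\<close>, then these two moves
  produce a crossing that excludes \<open>h\<close> or \<open>h\<^sub>2\<close>. Finally, if the Conradian condition failed for
  \<open>f, g \<in> S\<close>, the crossing \<open>(f, g, 1, f\<inverse>g, g\<^sup>2)\<close> would exclude the element \<open>g\<^sup>3\<close> of \<open>S\<close>.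

  Reversing the order exchanges the roles of \<open>f, g\<close> and of \<open>u, v\<close> in a crossing, hence \<open>S\<^sup>+\<close> and
  \<open>S\<^sup>-\<close>. So inverses of negative elements of \<open>S\<close> are covered as well, and products with arbitrary
  signs reduce to products of positive elements by convexity and inversion.
\<close>

section \<open>The order and the left action\<close>

context ordered_group
begin

abbreviation le (infix "\<preceq>" 50) where "x \<preceq> y \<equiv> (x, y) \<in> R"

definition lt (infix "\<prec>" 50) where "x \<prec> y \<longleftrightarrow> x \<preceq> y \<and> x \<noteq> y"

lemma le_refl: "x \<in> carrier G \<Longrightarrow> x \<preceq> x"
  using linear_order
  by (auto simp: linear_order_on_def partial_order_on_def preorder_on_def refl_on_def)

lemma le_trans [trans]: "x \<preceq> y \<Longrightarrow> y \<preceq> z \<Longrightarrow> x \<preceq> z"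
  using linear_order
  by (auto simp: linear_order_on_def partial_order_on_def preorder_on_def dest: transD)

lemma le_antisym: "x \<preceq> y \<Longrightarrow> y \<preceq> x \<Longrightarrow> x = y"
  using linear_order
  by (auto simp: linear_order_on_def partial_order_on_def dest: antisymD)

lemma lt_trans [trans]: "x \<prec> y \<Longrightarrow> y \<prec> z \<Longrightarrow> x \<prec> z"
  unfolding lt_def by (metis le_trans le_antisym)

lemma le_lt_trans [trans]: "x \<preceq> y \<Longrightarrow> y \<prec> z \<Longrightarrow> x \<prec> z"
  unfolding lt_def by (metis le_trans le_antisym)

lemma lt_le_trans [trans]: "x \<prec> y \<Longrightarrow> y \<preceq> z \<Longrightarrow> x \<prec> z"
  unfolding lt_def by (metis le_trans le_antisym)

lemma lt_imp_le: "x \<prec> y \<Longrightarrow> x \<preceq> y"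
  by (simp add: lt_def)

lemma not_le_iff: "x \<in> carrier G \<Longrightarrow> y \<in> carrier G \<Longrightarrow> \<not> x \<preceq> y \<longleftrightarrow> y \<prec> x"
  using linear_order le_refl le_antisym
  unfolding linear_order_on_def total_on_def lt_def by metis

lemma lt_asym: "x \<prec> y \<Longrightarrow> \<not> y \<preceq> x"
  unfolding lt_def using le_antisym by blast

lemma mult_lt_mono:
  assumes "h \<in> carrier G" "x \<in> carrier G" "y \<in> carrier G" "x \<prec> y"
  shows "h \<otimes> x \<prec> h \<otimes> y"
  using assms left_invariant by (auto simp: lt_def)

lemma mult_lt_iff:
  assumes "h \<in> carrier G" "x \<in> carrier G" "y \<in> carrier G"
  shows "h \<otimes> x \<prec> h \<otimes> y \<longleftrightarrow> x \<prec> y"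
  using assms mult_lt_mono[of "inv h" "h \<otimes> x" "h \<otimes> y"] mult_lt_mono[of h x y]
  by (auto simp: m_assoc[symmetric])

lemma inv_mult_cancel_left [simp]:
  "h \<in> carrier G \<Longrightarrow> x \<in> carrier G \<Longrightarrow> inv h \<otimes> (h \<otimes> x) = x"
  by (simp add: m_assoc[symmetric])

lemma mult_inv_cancel_left [simp]:
  "h \<in> carrier G \<Longrightarrow> x \<in> carrier G \<Longrightarrow> h \<otimes> (inv h \<otimes> x) = x"
  by (simp add: m_assoc[symmetric])

lemma inv_lt_one_iff: "h \<in> carrier G \<Longrightarrow> inv h \<prec> \<one> \<longleftrightarrow> \<one> \<prec> h"
  using mult_lt_iff[of h "inv h" \<one>] by simp

lemma one_lt_inv_iff: "h \<in> carrier G \<Longrightarrow> \<one> \<prec> inv h \<longleftrightarrow> h \<prec> \<one>"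
  using mult_lt_iff[of h \<one> "inv h"] by simp

lemma le_pow_mult:
  assumes "f \<in> carrier G" "x \<in> carrier G" "x \<prec> f \<otimes> x"
  shows "x \<preceq> f [^] (n::nat) \<otimes> x"
proof (induction n)
  case (Suc n)
  have "f [^] n \<otimes> x \<prec> f [^] n \<otimes> (f \<otimes> x)"
    using assms by (intro mult_lt_mono) auto
  with Suc have "x \<prec> f [^] n \<otimes> (f \<otimes> x)" by (rule le_lt_trans)
  then show ?case using assms by (simp add: m_assoc lt_def)
qed (use assms le_refl in simp)

lemma conj_pow_mult:
  assumes "h \<in> carrier G" "f \<in> carrier G" "x \<in> carrier G"
  shows "(h \<otimes> f \<otimes> inv h) [^] (n::nat) \<otimes> (h \<otimes> x) = h \<otimes> (f [^] n \<otimes> x)"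
  using assms(3)
proof (induction n arbitrary: x)
  case (Suc n)
  have "(h \<otimes> f \<otimes> inv h) \<otimes> (h \<otimes> x) = h \<otimes> (f \<otimes> x)"
    using assms Suc.prems by (simp add: m_assoc)
  then show ?case
    using assms Suc by (simp add: m_assoc)
qed (use assms in simp)

section \<open>Crossings\<close>

lemma crossing_iff:
  "crossing G R f g u v w \<longleftrightarrow>
    f \<in> carrier G \<and> g \<in> carrier G \<and> u \<in> carrier G \<and> v \<in> carrier G \<and> w \<in> carrier G \<and>
    u \<prec> w \<and> w \<prec> v \<and>
    (\<forall>n::nat. n \<ge> 1 \<longrightarrow> g [^] n \<otimes> u \<prec> v \<and> u \<prec> f [^] n \<otimes> v) \<and>
    (\<exists>(M::nat) (N::nat). M \<ge> 1 \<and> N \<ge> 1 \<and> f [^] N \<otimes> v \<prec> w \<and> w \<prec> g [^] M \<otimes> u)"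
  unfolding crossing_def lt_def by simp

lemma crossingI:
  assumes "f \<in> carrier G" "g \<in> carrier G" "u \<in> carrier G" "v \<in> carrier G" "w \<in> carrier G"
    and "u \<prec> w" "w \<prec> v"
    and "\<And>n::nat. n \<ge> 1 \<Longrightarrow> g [^] n \<otimes> u \<prec> v" "\<And>n::nat. n \<ge> 1 \<Longrightarrow> u \<prec> f [^] n \<otimes> v"
    and "f [^] Suc N \<otimes> v \<prec> w" "w \<prec> g [^] Suc M \<otimes> u"
  shows "crossing G R f g u v w"
proof -
  have "Suc M \<ge> 1" "Suc N \<ge> 1" by simp_all
  then show ?thesis
    unfolding crossing_iff using assms by (intro conjI allI impI exI[of _ "Suc M"] exI[of _ "Suc N"])
qed

text \<open>A crossing with \<open>M = N = 1\<close>; every crossing becomes one after passing to powers.\<close>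

definition strong_crossing :: "'a \<Rightarrow> 'a \<Rightarrow> 'a \<Rightarrow> 'a \<Rightarrow> 'a \<Rightarrow> bool" where
  "strong_crossing f g u v w \<longleftrightarrow>
    f \<in> carrier G \<and> g \<in> carrier G \<and> u \<in> carrier G \<and> v \<in> carrier G \<and> w \<in> carrier G \<and>
    u \<prec> w \<and> w \<prec> v \<and> f \<otimes> v \<prec> w \<and> w \<prec> g \<otimes> u \<and>
    (\<forall>n::nat. g [^] n \<otimes> u \<prec> v \<and> u \<prec> f [^] n \<otimes> v)"

lemma crossing_obtains_strong:
  assumes "crossing G R f g u v w"
  obtains f' g' where "strong_crossing f' g' u v w"
proof -
  obtain M N :: nat where "M \<ge> 1" "N \<ge> 1" "f [^] N \<otimes> v \<prec> w" "w \<prec> g [^] M \<otimes> u"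
    and c: "f \<in> carrier G" "g \<in> carrier G" "u \<in> carrier G" "v \<in> carrier G" "w \<in> carrier G"
    and o: "u \<prec> w" "w \<prec> v"
    and p: "\<And>n::nat. n \<ge> 1 \<Longrightarrow> g [^] n \<otimes> u \<prec> v \<and> u \<prec> f [^] n \<otimes> v"
    using assms unfolding crossing_iff by blast
  moreover have "(g [^] M) [^] n \<otimes> u \<prec> v \<and> u \<prec> (f [^] N) [^] n \<otimes> v" for n :: nat
  proof (cases n)
    case 0
    then show ?thesis using c o lt_trans by simp
  next
    case (Suc k)
    then have "M * n \<ge> 1" "N * n \<ge> 1" using \<open>M \<ge> 1\<close> \<open>N \<ge> 1\<close> by simp_all
    then show ?thesis using p c by (simp add: nat_pow_pow)
  qed
  ultimately have "strong_crossing (f [^] N) (g [^] M) u v w"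
    unfolding strong_crossing_def by simp
  then show ?thesis by (rule that)
qed

text \<open>
  Under a strong crossing \<open>w\<close> behaves like the endpoints: since \<open>f v \<prec> w\<close>, the point \<open>f w\<close> is still
  above \<open>f\<^sup>2 v\<close> and hence above \<open>u\<close>; similarly \<open>g\<^sup>n w\<close> is below \<open>g\<^sup>n\<^sup>+\<^sup>1 u\<close>.
\<close>

lemma strong_crossing_middle:
  assumes "strong_crossing f g u v w"
  shows "u \<prec> f \<otimes> w" "f \<otimes> w \<prec> w" "w \<prec> g \<otimes> w" "g [^] (n::nat) \<otimes> w \<prec> v"
    "w \<prec> g \<otimes> f \<otimes> w"
proof -
  note s = assms[unfolded strong_crossing_def]
  have c: "f \<in> carrier G" "g \<in> carrier G" "u \<in> carrier G" "v \<in> carrier G" "w \<in> carrier G"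
    using s by auto
  have "u \<prec> f [^] (2::nat) \<otimes> v" using s by blast
  also have "f [^] (2::nat) \<otimes> v = f \<otimes> (f \<otimes> v)"
    using c by (simp add: numeral_2_eq_2 m_assoc)
  also have "\<dots> \<prec> f \<otimes> w" using s by (intro mult_lt_mono) auto
  finally show *: "u \<prec> f \<otimes> w" .
  have "f \<otimes> w \<prec> f \<otimes> v" using s by (intro mult_lt_mono) auto
  also have "\<dots> \<prec> w" using s by blast
  finally show "f \<otimes> w \<prec> w" .
  have "w \<prec> g \<otimes> u" using s by blast
  also have "\<dots> \<prec> g \<otimes> w" using s by (intro mult_lt_mono) auto
  finally show "w \<prec> g \<otimes> w" .
  have "g [^] n \<otimes> w \<prec> g [^] n \<otimes> (g \<otimes> u)" using s by (intro mult_lt_mono) auto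
  also have "\<dots> = g [^] Suc n \<otimes> u" using c by (simp add: m_assoc)
  also have "\<dots> \<prec> v" using s by blast
  finally show "g [^] n \<otimes> w \<prec> v" .
  have "w \<prec> g \<otimes> u" using s by blast
  also have "\<dots> \<prec> g \<otimes> (f \<otimes> w)" using * c by (intro mult_lt_mono) auto
  finally show "w \<prec> g \<otimes> f \<otimes> w" using c by (simp add: m_assoc)
qed

text \<open>
  The map \<open>gf\<close> moves \<open>w\<close> up but \<open>v\<close> down to below \<open>g w\<close>, so it can replace \<open>f\<close> when \<open>w\<close> takes over
  the role of the lower endpoint.
\<close>

lemma upper_crossing:
  assumes "strong_crossing f g u v w"
  shows "crossing G R (g \<otimes> f) g w v (g \<otimes> w)"
proof -
  note s = assms[unfolded strong_crossing_def]
  note m = strong_crossing_middle[OF assms]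
  have c: "f \<in> carrier G" "g \<in> carrier G" "u \<in> carrier G" "v \<in> carrier G" "w \<in> carrier G"
    using s by auto
  have "w \<prec> (g \<otimes> f) [^] n \<otimes> v" for n :: nat
  proof -
    have "w \<preceq> (g \<otimes> f) [^] n \<otimes> w" using c m(5) by (intro le_pow_mult) auto
    also have "(g \<otimes> f) [^] n \<otimes> w \<prec> (g \<otimes> f) [^] n \<otimes> v" using s by (intro mult_lt_mono) auto
    finally show ?thesis .
  qed
  moreover have "(g \<otimes> f) [^] Suc 0 \<otimes> v \<prec> g \<otimes> w"
    using c s mult_lt_mono[of g "f \<otimes> v" w] by (simp add: m_assoc)
  moreover have "g \<otimes> w \<prec> g [^] Suc 1 \<otimes> w"
    using c m(3) mult_lt_mono[of g w "g \<otimes> w"] by (simp add: m_assoc)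
  moreover have "g \<otimes> w \<prec> v" using m(4)[of 1] c by simp
  ultimately show ?thesis
    using c m(3,4) by (intro crossingI[where M = 1 and N = 0]) simp_all
qed

lemma crossing_replace_middle:
  assumes "strong_crossing f g u v w"
  shows "crossing G R f g u v (f \<otimes> w)"
proof -
  note s = assms[unfolded strong_crossing_def]
  note m = strong_crossing_middle[OF assms]
  have c: "f \<in> carrier G" "g \<in> carrier G" "u \<in> carrier G" "v \<in> carrier G" "w \<in> carrier G"
    using s by auto
  have "f [^] Suc 1 \<otimes> v \<prec> f \<otimes> w"
    using c s mult_lt_mono[of f "f \<otimes> v" w] by (simp add: m_assoc)
  moreover have "f \<otimes> w \<prec> g [^] Suc 0 \<otimes> u"
    using lt_trans[OF m(2), of "g \<otimes> u"] c s by simp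
  moreover have "f \<otimes> w \<prec> v"
    using lt_trans[OF m(2), of v] s by simp
  ultimately show ?thesis
    using c s m(1) by (intro crossingI[where M = 0 and N = 1]) simp_all
qed

lemma conj_crossing:
  assumes "crossing G R f g u v w" "h \<in> carrier G"
  shows "crossing G R (h \<otimes> f \<otimes> inv h) (h \<otimes> g \<otimes> inv h) (h \<otimes> u) (h \<otimes> v) (h \<otimes> w)"
  using assms unfolding crossing_iff by (simp add: conj_pow_mult mult_lt_iff)

text \<open>
  Seen from \<open>w\<close>, both \<open>g\<close> and \<open>gf\<close> move upwards. But \<open>g\<^sup>n w\<close> stays below \<open>v\<close>, which \<open>f\<close> sends below
  \<open>w\<close>, so \<open>g f g\<^sup>n w\<close> never gets above \<open>g w\<close>.
\<close>

lemma strong_crossing_violation: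
  assumes "strong_crossing f g u v w"
  defines "p \<equiv> inv w \<otimes> (g \<otimes> f \<otimes> w)" and "q \<equiv> inv w \<otimes> (g \<otimes> w)"
  shows "\<one> \<prec> p" "\<one> \<prec> q" "p \<otimes> q [^] (n::nat) \<prec> q"
proof -
  note s = assms(1)[unfolded strong_crossing_def]
  note m = strong_crossing_middle[OF assms(1)]
  have c: "f \<in> carrier G" "g \<in> carrier G" "u \<in> carrier G" "v \<in> carrier G" "w \<in> carrier G"
    using s by auto
  show "\<one> \<prec> p" using mult_lt_mono[of "inv w" w "g \<otimes> f \<otimes> w"] c m(5) by (simp add: p_def)
  show "\<one> \<prec> q" using mult_lt_mono[of "inv w" w "g \<otimes> w"] c m(3) by (simp add: q_def)
  have "q [^] n = (inv w \<otimes> g \<otimes> inv (inv w)) [^] n \<otimes> (inv w \<otimes> w)"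
    using c by (simp add: q_def m_assoc)
  also have "\<dots> = inv w \<otimes> (g [^] n \<otimes> w)"
    using c by (intro conj_pow_mult) auto
  finally have q: "q [^] n = inv w \<otimes> (g [^] n \<otimes> w)" .
  have "p \<otimes> q [^] n = inv w \<otimes> (g \<otimes> (f \<otimes> (g [^] n \<otimes> w)))"
    unfolding p_def q using c by (simp add: m_assoc)
  also have "\<dots> \<prec> q"
  proof -
    have "f \<otimes> (g [^] n \<otimes> w) \<prec> f \<otimes> v" using m(4) c by (intro mult_lt_mono) auto
    also have "\<dots> \<prec> w" using s by blast
    finally show ?thesis unfolding q_def using c by (simp add: mult_lt_iff)
  qed
  finally show "p \<otimes> q [^] n \<prec> q" .
qed

section \<open>Conradian subgroups\<close>

lemma conradian_subgroup_iff:
  "conradian_subgroup G R H \<longleftrightarrow> subgroup H G \<and>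
    (\<forall>f\<in>H. \<forall>g\<in>H. \<one> \<prec> f \<longrightarrow> \<one> \<prec> g \<longrightarrow> (\<exists>n::nat. n \<ge> 1 \<and> g \<prec> f \<otimes> g [^] n))"
proof (cases "subgroup H G")
  case True
  then interpret H: subgroup H G .
  have "g [^] n \<in> H" if "g \<in> H" for g and n :: nat
    using that by (induction n) auto
  then show ?thesis
    using True
    by (auto simp: conradian_subgroup_def conradian_def lt_def nat_pow_consistent[symmetric]
        intro: H.m_closed)
qed (simp add: conradian_subgroup_def)

lemma strong_crossing_not_conradian:
  assumes "strong_crossing f g u v w" "f \<in> H" "g \<in> H" "w \<in> H"
  shows "\<not> conradian_subgroup G R H"
proof
  assume conradian: "conradian_subgroup G R H"
  then interpret H: subgroup H G by (simp add: conradian_subgroup_iff)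
  note viol = strong_crossing_violation[OF assms(1)]
  have "inv w \<otimes> (g \<otimes> f \<otimes> w) \<in> H" "inv w \<otimes> (g \<otimes> w) \<in> H"
    using assms by auto
  then obtain n :: nat
    where "inv w \<otimes> (g \<otimes> w) \<prec> inv w \<otimes> (g \<otimes> f \<otimes> w) \<otimes> (inv w \<otimes> (g \<otimes> w)) [^] n"
    using conradian viol(1,2) unfolding conradian_subgroup_iff by blast
  with viol(3)[of n] show False using lt_asym lt_imp_le by blast
qed

text \<open>
  The assumption says that the increasing sequence of points \<open>g\<^sup>n\<close> stays below \<open>f\<inverse>g\<close>. On the other
  side \<open>f\<close> moves \<open>f\<inverse>g\<close> down to \<open>g\<close>, and no further power brings it down to \<open>1\<close>, because
  \<open>f\<^sup>k g \<succ> f\<^sup>k \<succeq> 1\<close>. Any point strictly between \<open>g\<close> and \<open>f\<inverse>g\<close> that some \<open>g\<^sup>n\<close> exceeds can be the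
  middle point; \<open>g\<^sup>2\<close> is one.
\<close>

lemma crossing_if_not_conradian:
  assumes c: "f \<in> carrier G" "g \<in> carrier G" and pos: "\<one> \<prec> f" "\<one> \<prec> g"
    and viol: "\<And>n::nat. n \<ge> 1 \<Longrightarrow> f \<otimes> g [^] n \<preceq> g"
  shows "crossing G R f g \<one> (inv f \<otimes> g) (g [^] (2::nat))"
proof -
  have pow_Suc: "g [^] n \<prec> g [^] Suc n" for n :: nat
    using mult_lt_mono[of "g [^] n" \<one> g] c pos by simp
  have below: "g [^] n \<prec> inv f \<otimes> g" for n :: nat
  proof -
    have "f \<otimes> g [^] n \<prec> f \<otimes> g [^] Suc n" using pow_Suc c by (intro mult_lt_mono) auto
    also have "\<dots> \<preceq> g" by (rule viol) simp
    finally show ?thesis using c mult_lt_iff[of f "g [^] n" "inv f \<otimes> g"] by simp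
  qed
  have above: "\<one> \<prec> f [^] n \<otimes> (inv f \<otimes> g)" if n: "n \<ge> 1" for n :: nat
  proof -
    obtain k where k: "n = Suc k" using n by (cases n) auto
    have "\<one> \<preceq> f [^] k" using le_pow_mult[of f \<one> k] c pos by simp
    also have "f [^] k \<prec> f [^] k \<otimes> g"
      using mult_lt_mono[of "f [^] k" \<one> g] c pos by simp
    also have "\<dots> = f [^] n \<otimes> (inv f \<otimes> g)"
      unfolding k using c by (simp add: m_assoc)
    finally show ?thesis .
  qed
  have "g \<prec> g [^] (2::nat)" "g [^] (2::nat) \<prec> g [^] Suc 2"
    using pow_Suc[of 1] pow_Suc[of 2] c by (simp_all add: numeral_2_eq_2)
  moreover have "\<one> \<prec> g [^] (2::nat)"
    using pos(2) calculation(1) by (rule lt_trans)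
  ultimately show ?thesis
    using c below above by (intro crossingI[where M = 2 and N = 0]) simp_all
qed

section \<open>The set S\<close>

lemma S_plus_iff:
  "h \<in> S_plus G R \<longleftrightarrow> h \<in> carrier G \<and> \<one> \<prec> h \<and>
    (\<forall>f g u v w. crossing G R f g u v w \<and> \<one> \<preceq> u \<longrightarrow> h \<preceq> w)"
  by (auto simp: S_plus_def lt_def)

lemma S_minus_iff:
  "h \<in> S_minus G R \<longleftrightarrow> h \<in> carrier G \<and> h \<prec> \<one> \<and>
    (\<forall>f g u v w. crossing G R f g u v w \<and> v \<preceq> \<one> \<longrightarrow> w \<preceq> h)"
  by (auto simp: S_minus_def lt_def)

lemma S_plus_le:
  "h \<in> S_plus G R \<Longrightarrow> crossing G R f g u v w \<Longrightarrow> \<one> \<preceq> u \<Longrightarrow> h \<preceq> w"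
  by (auto simp: S_plus_iff)

lemma crossing_carrier:
  "crossing G R f g u v w \<Longrightarrow>
    f \<in> carrier G \<and> g \<in> carrier G \<and> u \<in> carrier G \<and> v \<in> carrier G \<and> w \<in> carrier G"
  by (simp add: crossing_def)

lemma ordered_group_converse: "ordered_group G (R\<inverse>)"
  using linear_order left_invariant
  by unfold_locales auto

lemma crossing_converse: "crossing G (R\<inverse>) f g u v w \<longleftrightarrow> crossing G R g f v u w"
  unfolding crossing_def converse_iff by (rule iffI; (elim conjE exE)?; intro conjI allI impI; blast)

lemma S_plus_converse: "S_plus G (R\<inverse>) = S_minus G R"
  unfolding S_plus_def S_minus_def crossing_converse by auto

lemma S_minus_converse: "S_minus G (R\<inverse>) = S_plus G R"
  unfolding S_plus_def S_minus_def crossing_converse by auto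

text \<open>
  If a crossing with \<open>h\<inverse> \<prec> w\<close> and \<open>v \<preceq> 1\<close> excludes \<open>h\<inverse>\<close>, then the upper part of this crossing,
  translated by \<open>h\<close>, lies between \<open>h w \<succ> 1\<close> and \<open>h v \<preceq> h\<close>, so it excludes \<open>h\<close>.
\<close>

lemma inv_S_plus:
  assumes h: "h \<in> S_plus G R"
  shows "inv h \<in> S_minus G R"
proof -
  have hc: "h \<in> carrier G" and hpos: "\<one> \<prec> h" using h by (auto simp: S_plus_iff)
  have "w \<preceq> inv h" if cr: "crossing G R f g u v w" and v: "v \<preceq> \<one>" for f g u v w
  proof (rule ccontr)
    assume n: "\<not> w \<preceq> inv h"
    have wc: "w \<in> carrier G" and vc: "v \<in> carrier G" using crossing_carrier[OF cr] by auto
    obtain f' g' where s: "strong_crossing f' g' u v w"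
      using crossing_obtains_strong[OF cr] .
    have gc: "g' \<in> carrier G" using s by (simp add: strong_crossing_def)
    have "inv h \<prec> w" using n wc hc by (simp add: not_le_iff)
    then have "\<one> \<prec> h \<otimes> w" using mult_lt_mono[of h "inv h" w] hc wc by simp
    then have "h \<preceq> h \<otimes> (g' \<otimes> w)"
      using S_plus_le[OF h conj_crossing[OF upper_crossing[OF s] hc]] by (simp add: lt_def)
    moreover have "h \<otimes> (g' \<otimes> w) \<prec> h \<otimes> v"
      using strong_crossing_middle(4)[OF s, of 1] gc hc wc vc by (intro mult_lt_mono) auto
    moreover have "h \<otimes> v \<preceq> h" using left_invariant[of h v \<one>] v hc vc by simp
    ultimately show False using lt_asym lt_le_trans by blast
  qed
  then show ?thesis using hc hpos by (auto simp: S_minus_iff inv_lt_one_iff)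
qed

lemma inv_S_minus: "h \<in> S_minus G R \<Longrightarrow> inv h \<in> S_plus G R"
  using ordered_group.inv_S_plus[OF ordered_group_converse]
  by (simp add: S_plus_converse S_minus_converse)

text \<open>
  Suppose that a crossing with \<open>1 \<preceq> u\<close> and \<open>w \<prec> h\<^sub>1h\<^sub>2\<close> excludes \<open>h\<^sub>1h\<^sub>2\<close>. Its upper part,
  translated by \<open>f\<close>, lies between \<open>f w\<close> and \<open>f v \<prec> w\<close>, so it still excludes \<open>h\<^sub>1h\<^sub>2\<close>. Moreover
  \<open>h\<^sub>1 \<preceq> f w\<close>, because \<open>f w\<close> can replace \<open>w\<close> in the given crossing. Hence one may translate further
  by \<open>h\<^sub>1\<inverse>\<close> and get a crossing that excludes \<open>h\<^sub>2\<close>.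
\<close>

lemma mult_S_plus:
  assumes h1: "h\<^sub>1 \<in> S_plus G R" and h2: "h\<^sub>2 \<in> S_plus G R"
  shows "h\<^sub>1 \<otimes> h\<^sub>2 \<in> S_plus G R"
proof -
  have hc: "h\<^sub>1 \<in> carrier G" "h\<^sub>2 \<in> carrier G" and hpos: "\<one> \<prec> h\<^sub>1" "\<one> \<prec> h\<^sub>2"
    using h1 h2 by (auto simp: S_plus_iff)
  have "h\<^sub>1 \<otimes> h\<^sub>2 \<preceq> w" if cr: "crossing G R f\<^sub>0 g\<^sub>0 u v w" and u: "\<one> \<preceq> u" for f\<^sub>0 g\<^sub>0 u v w
  proof (rule ccontr)
    assume n: "\<not> h\<^sub>1 \<otimes> h\<^sub>2 \<preceq> w"
    obtain f g where s: "strong_crossing f g u v w"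
      using crossing_obtains_strong[OF cr] .
    have c: "f \<in> carrier G" "g \<in> carrier G" "u \<in> carrier G" "v \<in> carrier G" "w \<in> carrier G"
      and fv: "f \<otimes> v \<prec> w"
      using s by (auto simp: strong_crossing_def)
    have low: "h\<^sub>1 \<preceq> f \<otimes> w"
      using S_plus_le[OF h1 crossing_replace_middle[OF s] u] .
    have "f \<otimes> (g \<otimes> w) \<prec> f \<otimes> v"
      using strong_crossing_middle(4)[OF s, of 1] c by (intro mult_lt_mono) auto
    also have "\<dots> \<prec> w" by (rule fv)
    also have "\<dots> \<prec> h\<^sub>1 \<otimes> h\<^sub>2" using n c hc by (simp add: not_le_iff)
    finally have "inv h\<^sub>1 \<otimes> (f \<otimes> (g \<otimes> w)) \<prec> inv h\<^sub>1 \<otimes> (h\<^sub>1 \<otimes> h\<^sub>2)"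
      using c hc by (intro mult_lt_mono) auto
    also have "\<dots> = h\<^sub>2" using hc by simp
    finally have high: "inv h\<^sub>1 \<otimes> (f \<otimes> (g \<otimes> w)) \<prec> h\<^sub>2" .
    have "\<one> \<preceq> inv h\<^sub>1 \<otimes> (f \<otimes> w)"
      using left_invariant[of "inv h\<^sub>1" h\<^sub>1 "f \<otimes> w"] low c hc by simp
    then have "h\<^sub>2 \<preceq> inv h\<^sub>1 \<otimes> (f \<otimes> (g \<otimes> w))"
      using S_plus_le[OF h2 conj_crossing[OF conj_crossing[OF upper_crossing[OF s] c(1)]]] hc
      by simp
    with high show False using lt_asym by blast
  qed
  moreover have "\<one> \<prec> h\<^sub>1 \<otimes> h\<^sub>2"
    using mult_lt_mono[of h\<^sub>1 \<one> h\<^sub>2] hc hpos lt_trans by simp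
  ultimately show ?thesis using hc unfolding S_plus_iff by auto
qed

definition soul :: "'a set" where
  "soul = {\<one>} \<union> S_plus G R \<union> S_minus G R"

lemma soul_carrier: "soul \<subseteq> carrier G"
  by (auto simp: soul_def S_plus_iff S_minus_iff)

lemma inv_soul: "h \<in> soul \<Longrightarrow> inv h \<in> soul"
  by (auto simp: soul_def dest: inv_S_plus inv_S_minus)

lemma soul_positive: "h \<in> soul \<Longrightarrow> \<one> \<prec> h \<Longrightarrow> h \<in> S_plus G R"
  using lt_asym[of \<one> h] by (auto simp: soul_def S_minus_iff lt_def)

lemma S_plus_downward:
  assumes "h \<in> S_plus G R" "x \<in> carrier G" "\<one> \<prec> x" "x \<preceq> h"
  shows "x \<in> S_plus G R"
  using assms unfolding S_plus_iff by (meson le_trans)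

lemma S_minus_upward:
  assumes "h \<in> S_minus G R" "x \<in> carrier G" "x \<prec> \<one>" "h \<preceq> x"
  shows "x \<in> S_minus G R"
  using assms unfolding S_minus_iff by (meson le_trans)

lemma one_trichotomy:
  assumes "x \<in> carrier G"
  obtains "x = \<one>" | "\<one> \<prec> x" | "x \<prec> \<one>"
  using assms not_le_iff[of x \<one>] by (auto simp: lt_def)

lemma soul_between:
  assumes "a \<in> soul" "b \<in> soul" "x \<in> carrier G" "a \<preceq> x" "x \<preceq> b"
  shows "x \<in> soul"
  using assms(3)
proof (cases x rule: one_trichotomy)
  case 2
  then have "\<one> \<prec> b" using assms(5) lt_le_trans by blast
  then have "x \<in> S_plus G R" using 2 assms S_plus_downward soul_positive by blast
  then show ?thesis by (simp add: soul_def)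
next
  case 3
  then have "a \<prec> \<one>" using assms(4) le_lt_trans by blast
  then have "a \<in> S_minus G R"
    using assms(1) lt_asym[of a \<one>] by (auto simp: soul_def S_plus_iff lt_def)
  then have "x \<in> S_minus G R" using 3 assms S_minus_upward by blast
  then show ?thesis by (simp add: soul_def)
qed (simp add: soul_def)

lemma convex_soul: "convex_subset G R soul"
  unfolding convex_subset_def using soul_carrier soul_between by blast

lemma mult_soul_of_positive:
  assumes "a \<in> soul" "b \<in> soul" and pos: "\<one> \<preceq> a \<otimes> b"
  shows "a \<otimes> b \<in> soul"
proof -
  have c: "a \<in> carrier G" "b \<in> carrier G" using assms soul_carrier by auto
  have one: "\<one> \<in> soul" by (simp add: soul_def)
  from c(2) show ?thesis
  proof (cases b rule: one_trichotomy)
    case 1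
    then show ?thesis using assms(1) c by simp
  next
    case b: 2
    from c(1) show ?thesis
    proof (cases a rule: one_trichotomy)
      case 1
      then show ?thesis using assms(2) c by simp
    next
      case 2
      then have "a \<otimes> b \<in> S_plus G R"
        using assms b by (intro mult_S_plus soul_positive)
      then show ?thesis by (simp add: soul_def)
    next
      case 3
      \<comment> \<open>Left invariance does not bound \<open>a b\<close> by \<open>b\<close>, but it bounds \<open>(a b)\<inverse>\<close> from below by \<open>b\<inverse>\<close>.\<close>
      have "inv b \<prec> inv b \<otimes> inv a"
        using mult_lt_mono[of "inv b" \<one> "inv a"] c 3 one_lt_inv_iff by simp
      moreover have "inv b \<otimes> inv a \<preceq> \<one>"
        using left_invariant[of "inv (a \<otimes> b)" \<one> "a \<otimes> b"] pos c by (simp add: inv_mult_group m_assoc)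
      ultimately have "inv b \<otimes> inv a \<in> soul"
        using soul_between[OF inv_soul[OF assms(2)] one] c lt_imp_le by simp
      then show ?thesis using inv_soul c by (fastforce simp: inv_mult_group)
    qed
  next
    case 3
    have "a \<otimes> b \<prec> a" using mult_lt_mono[of a b \<one>] 3 c by simp
    then show ?thesis using soul_between[OF one assms(1)] pos c lt_imp_le by simp
  qed
qed

lemma mult_soul:
  assumes "a \<in> soul" "b \<in> soul"
  shows "a \<otimes> b \<in> soul"
proof (cases "\<one> \<preceq> a \<otimes> b")
  case False
  have c: "a \<in> carrier G" "b \<in> carrier G" using assms soul_carrier by auto
  then have "\<one> \<prec> inv (a \<otimes> b)"
    using False not_le_iff one_lt_inv_iff by simp
  then have "inv b \<otimes> inv a \<in> soul"
    using mult_soul_of_positive[OF inv_soul[OF assms(2)] inv_soul[OF assms(1)]] c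
    by (simp add: inv_mult_group lt_def)
  then show ?thesis using inv_soul c by (fastforce simp: inv_mult_group)
qed (use assms mult_soul_of_positive in blast)

lemma subgroup_soul: "subgroup soul G"
  by (rule subgroupI) (use soul_carrier inv_soul mult_soul in \<open>auto simp: soul_def\<close>)

text \<open>
  A failure \<open>f g\<^sup>n \<preceq> g\<close> inside \<open>S\<close> produces a crossing with \<open>u = 1\<close> and \<open>w = g\<^sup>2\<close>, which excludes
  \<open>g\<^sup>3\<close>; but \<open>S\<close> is closed under powers.
\<close>

lemma conradian_subgroup_soul: "conradian_subgroup G R soul"
proof -
  have "\<exists>n::nat. n \<ge> 1 \<and> g \<prec> f \<otimes> g [^] n"
    if f: "f \<in> soul" "\<one> \<prec> f" and g: "g \<in> soul" "\<one> \<prec> g" for f g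
  proof (rule ccontr)
    assume n: "\<not> ?thesis"
    have c: "f \<in> carrier G" "g \<in> carrier G" using f g soul_carrier by auto
    have "f \<otimes> g [^] n \<preceq> g" if "n \<ge> 1" for n :: nat
      using n that c not_le_iff[of "f \<otimes> g [^] n" g] by auto
    from crossing_if_not_conradian[OF c f(2) g(2) this]
    have cr: "crossing G R f g \<one> (inv f \<otimes> g) (g [^] (2::nat))" .
    have "g \<in> S_plus G R" using g by (rule soul_positive)
    then have "g \<otimes> g \<otimes> g \<in> S_plus G R" by (intro mult_S_plus)
    then have "g \<otimes> g \<otimes> g \<preceq> g [^] (2::nat)" by (rule S_plus_le[OF _ cr]) (simp add: le_refl)
    moreover have "g [^] (2::nat) \<prec> g \<otimes> g \<otimes> g"
      using mult_lt_mono[of "g \<otimes> g" \<one> g] c g by (simp add: numeral_2_eq_2)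
    ultimately show False using lt_asym by blast
  qed
  then show ?thesis using subgroup_soul by (simp add: conradian_subgroup_iff)
qed

section \<open>Maximality\<close>

lemma convex_between:
  assumes "convex_subset G R H" "a \<in> H" "b \<in> H" "x \<in> carrier G" "a \<prec> x" "x \<prec> b"
  shows "x \<in> H"
  using assms unfolding convex_subset_def lt_def by blast

lemma subgroup_left_factor:
  assumes "subgroup H G" "f \<in> carrier G" "x \<in> H" "f \<otimes> x \<in> H"
  shows "f \<in> H"
proof -
  interpret H: subgroup H G by fact
  have "f = f \<otimes> x \<otimes> inv x" using assms by (simp add: m_assoc)
  then show ?thesis using assms H.m_closed H.m_inv_closed by metis
qed

text \<open>
  If \<open>h\<close> were above the point \<open>w\<close> of a crossing with \<open>1 \<preceq> u\<close>, then \<open>u\<close> and \<open>w\<close> would be in \<open>H\<close>. Both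
  \<open>f w\<close> and \<open>f v\<close> lie between them, which puts first \<open>f\<close> and then \<open>v\<close> into \<open>H\<close>; finally \<open>g u\<close> lies
  between \<open>w\<close> and \<open>v\<close>, which puts \<open>g\<close> into \<open>H\<close>. So \<open>H\<close> would contain the whole crossing.
\<close>

lemma conradian_convex_positive:
  assumes H: "convex_subset G R H" "conradian_subgroup G R H"
    and h: "h \<in> H" "\<one> \<prec> h"
  shows "h \<in> S_plus G R"
proof -
  have sub: "subgroup H G" using H(2) by (simp add: conradian_subgroup_iff)
  interpret H: subgroup H G by (rule sub)
  have "h \<preceq> w" if cr: "crossing G R f\<^sub>0 g\<^sub>0 u v w" and u: "\<one> \<preceq> u" for f\<^sub>0 g\<^sub>0 u v w
  proof (rule ccontr)
    assume n: "\<not> h \<preceq> w"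
    obtain f g where s: "strong_crossing f g u v w"
      using crossing_obtains_strong[OF cr] .
    have c: "f \<in> carrier G" "g \<in> carrier G" "u \<in> carrier G" "v \<in> carrier G" "w \<in> carrier G"
      and o: "u \<prec> w" "f \<otimes> v \<prec> w" "w \<prec> g \<otimes> u" "\<And>n::nat. u \<prec> f [^] n \<otimes> v"
        "\<And>n::nat. g [^] n \<otimes> u \<prec> v"
      using s by (simp_all add: strong_crossing_def del: nat_pow_Suc One_nat_def)
    have wh: "w \<prec> h" using n c h H.subset by (simp add: not_le_iff subset_iff)
    have "u \<prec> h" using o(1) wh by (rule lt_trans)
    then have uH: "u \<in> H"
      using convex_between[OF H(1) H.one_closed h(1) c(3)] u H.one_closed
      by (cases "u = \<one>") (auto simp: lt_def)
    have wH: "w \<in> H" using convex_between[OF H(1) uH h(1) c(5) o(1) wh] .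
    have fwH: "f \<otimes> w \<in> H"
      using convex_between[OF H(1) uH wH] strong_crossing_middle(1,2)[OF s] c by simp
    have fH: "f \<in> H" using subgroup_left_factor[OF sub c(1) wH fwH] .
    have fvH: "f \<otimes> v \<in> H" using convex_between[OF H(1) uH wH, of "f \<otimes> v"] o(2) o(4)[of 1] c by simp
    have "inv f \<otimes> (f \<otimes> v) \<in> H" using fH fvH by simp
    then have vH: "v \<in> H" using c by simp
    have guH: "g \<otimes> u \<in> H" using convex_between[OF H(1) wH vH, of "g \<otimes> u"] o(3) o(5)[of 1] c by simp
    have "g \<in> H" using subgroup_left_factor[OF sub c(2) uH guH] .
    then show False using strong_crossing_not_conradian[OF s fH _ wH] H(2) by blast
  qed
  then show ?thesis using h H.subset unfolding S_plus_iff by blast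
qed

lemma conradian_convex_subset_soul:
  assumes H: "convex_subset G R H" "conradian_subgroup G R H"
  shows "H \<subseteq> soul"
proof
  fix h assume h: "h \<in> H"
  interpret H: subgroup H G using H(2) by (simp add: conradian_subgroup_iff)
  have hc: "h \<in> carrier G" using h by simp
  then show "h \<in> soul"
  proof (cases h rule: one_trichotomy)
    case 2
    then show ?thesis using conradian_convex_positive[OF H h] by (simp add: soul_def)
  next
    case 3
    then have "inv h \<in> soul"
      using conradian_convex_positive[OF H, of "inv h"] h hc by (simp add: one_lt_inv_iff soul_def)
    then show ?thesis using inv_soul hc by fastforce
  qed (simp add: soul_def)
qed

lemma is_conradian_soul_iff: "is_conradian_soul G R C \<longleftrightarrow> C = soul"
  unfolding is_conradian_soul_def
  using convex_soul conradian_subgroup_soul conradian_convex_subset_soul by blast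

end

theorem theorem2p1:
  fixes G (structure) and R :: "'a rel"
  assumes "ordered_group G R"
  shows "is_conradian_soul G R C \<longleftrightarrow> C = {\<one>} \<union> S_plus G R \<union> S_minus G R"
proof -
  interpret ordered_group G R by fact
  show ?thesis using is_conradian_soul_iff unfolding soul_def .
qed

end
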